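(* Let $a\in\mathbb N^n$ be a weak composition, $1\le i<n$, and $S,T\in\mathrm{SSKD}(a)$. Then $e_i(S)=T$ if and only if $f_i(T)=S$.
   Context: The diagram of $a$ has cells $(r,c)$ (row $r$ from the bottom, column $c$ from the left) with $1\le c\le a_r$, augmented (following Haglund–Haiman–Loehr) by a basement column $0$ whose cell $(r,0)$ contains $r$, basement cells being included in the conditions below (row lengths compared without basement). Fillings have entries in $\{1,\dots,n\}$. Cells attack if in the same column, or in adjacent columns with the left cell strictly higher; non-attacking: attacking cells have different entries. A triple: cells $(r,c),(r,c+1)$ with entries $i,j$ and a third with entry $k$, either $(s,c)$, $s>r$, row $r$ strictly longer than row $s$, or $(s,c+1)$, $s<r$, row $r$ weakly longer than row $s$; co-inversion if $i<j<k$, $j<k<i$ or $k<i<j$. $\mathrm{SSKD}(a)$: non-attacking fillings with no co-inversion triples. $i$-pairing: pair an $i$ and an $i+1$ in the same column, then iteratively pair an unpaired $i+1$ with an unpaired $i$ to its left whenever all entries $i,i+1$ between them are paired. Raising $e_i$: $0$ if no unpaired $i+1$; otherwise change the rightmost unpaired $i+1$ to $i$, swap $i,i+1$ in each of the consecutive columns immediately to its left having an $i+1$ in the same row and an $i$ above, and in each of the consecutive columns immediately to its right having an $i+1$ in the same row and an $i$ below. Lowering $f_i$: $f_i(T)=0$ if $T$ has no unpaired $i$, or if the leftmost unpaired $i$ is in row $i$ and all columns to its left have an $i$ in that row with an $i+1$ above it; otherwise change the leftmost unpaired $i$ to $i+1$, swap $i,i+1$ in each of the consecutive columns immediately to its left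 having an $i$ in the same row and an $i+1$ above, and in each of the consecutive columns immediately to its right having an $i$ in the same row and an $i+1$ below. *)

theory Defs
  imports "HOL-Library.FuncSet" "HOL-Combinatorics.Transposition"
begin

text \<open>
  A weak composition of length \<open>n\<close> is a function \<open>a :: nat \<Rightarrow> nat\<close> of which only the values
  \<open>a 1, \<dots>, a n\<close> are used. A cell is a pair \<open>(r, c)\<close>: row \<open>r\<close> counted from the bottom,
  column \<open>c\<close> counted from the left, column \<open>0\<close> being the basement. A filling is defined on the
  cells outside the basement only and is extensional there, so that equality of
  fillings is equality of functions; \<^emph>\<open>aug\<close> supplies the basement entries.
\<close>

type_synonym cell = "nat \<times> nat"

definition diagram :: "nat \<Rightarrow> (nat \<Rightarrow> nat) \<Rightarrow> cell set" where
  "diagram n a = {(r, c). 1 \<le> r \<and> r \<le> n \<and> 1 \<le> c \<and> c \<le> a r}"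

definition aug_diagram :: "nat \<Rightarrow> (nat \<Rightarrow> nat) \<Rightarrow> cell set" where
  "aug_diagram n a = diagram n a \<union> {(r, c). 1 \<le> r \<and> r \<le> n \<and> c = 0}"

definition fillings :: "nat \<Rightarrow> (nat \<Rightarrow> nat) \<Rightarrow> (cell \<Rightarrow> nat) set" where
  "fillings n a = diagram n a \<rightarrow>\<^sub>E {1..n}"

definition aug :: "(cell \<Rightarrow> nat) \<Rightarrow> cell \<Rightarrow> nat" where
  "aug T = (\<lambda>(r, c). if c = 0 then r else T (r, c))"

text \<open>One orientation of each attacking pair of distinct columns is listed: the left cell first.\<close>

definition attacking :: "cell \<Rightarrow> cell \<Rightarrow> bool" where
  "attacking x y \<longleftrightarrow>
     (x \<noteq> y \<and> snd x = snd y) \<or> (snd y = snd x + 1 \<and> fst x > fst y)"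

definition non_attacking :: "nat \<Rightarrow> (nat \<Rightarrow> nat) \<Rightarrow> (cell \<Rightarrow> nat) \<Rightarrow> bool" where
  "non_attacking n a T \<longleftrightarrow>
     (\<forall>x \<in> aug_diagram n a. \<forall>y \<in> aug_diagram n a. attacking x y \<longrightarrow> aug T x \<noteq> aug T y)"

text \<open>A triple is given by its left cell, its right cell and its third cell.\<close>

definition triples :: "nat \<Rightarrow> (nat \<Rightarrow> nat) \<Rightarrow> (cell \<times> cell \<times> cell) set" where
  "triples n a =
     {((r, c), (r, c + 1), (s, c)) | r s c.
        {(r, c), (r, c + 1), (s, c)} \<subseteq> aug_diagram n a \<and> s > r \<and> a r > a s}
   \<union> {((r, c), (r, c + 1), (s, c + 1)) | r s c.
        {(r, c), (r, c + 1), (s, c + 1)} \<subseteq> aug_diagram n a \<and> s < r \<and> a r \<ge> a s}"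

definition coinversion :: "nat \<Rightarrow> nat \<Rightarrow> nat \<Rightarrow> bool" where
  "coinversion i j k \<longleftrightarrow> (i < j \<and> j < k) \<or> (j < k \<and> k < i) \<or> (k < i \<and> i < j)"

definition SSKD :: "nat \<Rightarrow> (nat \<Rightarrow> nat) \<Rightarrow> (cell \<Rightarrow> nat) set" where
  "SSKD n a = {T \<in> fillings n a. non_attacking n a T \<and>
     (\<forall>(x, y, z) \<in> triples n a. \<not> coinversion (aug T x) (aug T y) (aug T z))}"

text \<open>
  Pairs are written (cell containing \<open>i\<close>, cell containing \<open>i + 1\<close>). Stage \<open>0\<close> consists of the
  pairs within a column; stage \<open>k + 1\<close> adds at once every pair that the iteration rule admits
  relative to stage \<open>k\<close>. In a non-attacking filling an unpaired entry is the only \<open>i\<close> or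
  \<open>i + 1\<close> of its column, so pairs admitted simultaneously are disjoint and do not
  compete. The basement is left out: its \<open>i\<close> and \<open>i + 1\<close> are paired with each other and lie
  to the left of all other cells.
\<close>

primrec pairing_stage ::
  "nat \<Rightarrow> (nat \<Rightarrow> nat) \<Rightarrow> nat \<Rightarrow> (cell \<Rightarrow> nat) \<Rightarrow> nat \<Rightarrow> (cell \<times> cell) set" where
  "pairing_stage n a i T 0 =
     {(x, y). x \<in> diagram n a \<and> y \<in> diagram n a \<and> T x = i \<and> T y = i + 1 \<and> snd x = snd y}"
| "pairing_stage n a i T (Suc k) = pairing_stage n a i T k \<union>
     {(x, y). x \<in> diagram n a \<and> y \<in> diagram n a \<and> T x = i \<and> T y = i + 1 \<and> snd x < snd y
        \<and> x \<notin> Field (pairing_stage n a i T k) \<and> y \<notin> Field (pairing_stage n a i T k)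
        \<and> (\<forall>z \<in> diagram n a. snd x < snd z \<and> snd z < snd y \<and> T z \<in> {i, i + 1}
              \<longrightarrow> z \<in> Field (pairing_stage n a i T k))}"

definition unpaired :: "nat \<Rightarrow> (nat \<Rightarrow> nat) \<Rightarrow> nat \<Rightarrow> (cell \<Rightarrow> nat) \<Rightarrow> nat \<Rightarrow> cell set" where
  "unpaired n a i T v =
     {x \<in> diagram n a. T x = v \<and> x \<notin> Field (\<Union>k. pairing_stage n a i T k)}"

definition has_above ::
  "nat \<Rightarrow> (nat \<Rightarrow> nat) \<Rightarrow> (cell \<Rightarrow> nat) \<Rightarrow> nat \<Rightarrow> nat \<Rightarrow> nat \<Rightarrow> nat \<Rightarrow> bool" where
  "has_above n a T v w r d \<longleftrightarrow> (r, d) \<in> diagram n a \<and> T (r, d) = v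
     \<and> (\<exists>s > r. (s, d) \<in> diagram n a \<and> T (s, d) = w)"

definition has_below ::
  "nat \<Rightarrow> (nat \<Rightarrow> nat) \<Rightarrow> (cell \<Rightarrow> nat) \<Rightarrow> nat \<Rightarrow> nat \<Rightarrow> nat \<Rightarrow> nat \<Rightarrow> bool" where
  "has_below n a T v w r d \<longleftrightarrow> (r, d) \<in> diagram n a \<and> T (r, d) = v
     \<and> (\<exists>s < r. (s, d) \<in> diagram n a \<and> T (s, d) = w)"

text \<open>
  The change of the entry \<open>v\<close> of cell \<open>(r, c)\<close> into \<open>w\<close> that underlies both operators,
  with \<open>{v, w} = {i, i + 1}\<close>; \<open>swap_columns\<close> are the columns in which \<open>v\<close> and \<open>w\<close> are swapped.
  The basement is never changed.
\<close>

definition swap_columns ::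
  "nat \<Rightarrow> (nat \<Rightarrow> nat) \<Rightarrow> (cell \<Rightarrow> nat) \<Rightarrow> nat \<Rightarrow> nat \<Rightarrow> cell \<Rightarrow> nat set" where
  "swap_columns n a T v w = (\<lambda>(r, c).
     {d. 1 \<le> d \<and> d < c \<and> (\<forall>d' \<in> {d..<c}. has_above n a T v w r d')}
   \<union> {d. c < d \<and> (\<forall>d' \<in> {c<..d}. has_below n a T v w r d')})"

definition change_entry ::
  "nat \<Rightarrow> (nat \<Rightarrow> nat) \<Rightarrow> (cell \<Rightarrow> nat) \<Rightarrow> nat \<Rightarrow> nat \<Rightarrow> cell \<Rightarrow> cell \<Rightarrow> nat" where
  "change_entry n a T v w x = (\<lambda>y \<in> diagram n a.
     if y = x then w
     else if snd y \<in> swap_columns n a T v w x then transpose v w (T y)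
     else T y)"

text \<open>
  The value \<open>0\<close> of the operators is \<open>None\<close>. Rightmost and leftmost unpaired cells are unique,
  since a column of a non-attacking filling contains each entry at most once.
\<close>

definition raising ::
  "nat \<Rightarrow> (nat \<Rightarrow> nat) \<Rightarrow> nat \<Rightarrow> (cell \<Rightarrow> nat) \<Rightarrow> (cell \<Rightarrow> nat) option" where
  "raising n a i T =
     (if unpaired n a i T (i + 1) = {} then None
      else let x = arg_max snd (\<lambda>x. x \<in> unpaired n a i T (i + 1))
           in Some (change_entry n a T (i + 1) i x))"

definition lowering ::
  "nat \<Rightarrow> (nat \<Rightarrow> nat) \<Rightarrow> nat \<Rightarrow> (cell \<Rightarrow> nat) \<Rightarrow> (cell \<Rightarrow> nat) option" where
  "lowering n a i T =
     (if unpaired n a i T i = {} then None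
      else let x = arg_min snd (\<lambda>x. x \<in> unpaired n a i T i)
           in if fst x = i \<and> (\<forall>d \<in> {1..<snd x}. has_above n a T i (i + 1) i d) then None
              else Some (change_entry n a T i (i + 1) x))"

end

theory Submission
  imports Defs
begin

text \<open>
  The pairing depends only on the sets of columns containing an \<open>i\<close> and an \<open>i + 1\<close>. Turning the
  rightmost unpaired \<open>i + 1\<close> into an \<open>i\<close> moves one column from one set to the other and changes
  no pair, because no pair straddles an unpaired column; the new \<open>i\<close> is then the leftmost unpaired
  one, as an unpaired \<open>i\<close> never lies to the left of an unpaired \<open>i + 1\<close>. The columns swapped by the two
  operators coincide: if the run of the inverse operator were longer, its first extra column
  would attack the neighbouring cell in the original filling. The same argument with the
  basement as the extra column rules out the exceptional case in the lowering operator.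
\<close>

section \<open>Pairing of columns\<close>

primrec column_pairing :: "nat set \<Rightarrow> nat set \<Rightarrow> nat \<Rightarrow> (nat \<times> nat) set" where
  "column_pairing A B 0 = Id_on (A \<inter> B)"
| "column_pairing A B (Suc k) = column_pairing A B k \<union>
     {(u, v). u \<in> A \<and> v \<in> B \<and> u < v
        \<and> u \<notin> Field (column_pairing A B k) \<and> v \<notin> Field (column_pairing A B k)
        \<and> (\<forall>w. u < w \<and> w < v \<and> w \<in> A \<union> B \<longrightarrow> w \<in> Field (column_pairing A B k))}"

definition free_columns :: "nat set \<Rightarrow> nat set \<Rightarrow> nat set" where
  "free_columns A B = A \<union> B - (\<Union>k. Field (column_pairing A B k))"

lemma column_pairing_mono:
  "k \<le> l \<Longrightarrow> column_pairing A B k \<subseteq> column_pairing A B l"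
  by (rule lift_Suc_mono_le[of "column_pairing A B"]) auto

lemma Field_column_pairing_mono:
  "k \<le> l \<Longrightarrow> Field (column_pairing A B k) \<subseteq> Field (column_pairing A B l)"
  by (intro mono_Field column_pairing_mono)

lemma column_pairingD:
  "(u, v) \<in> column_pairing A B k \<Longrightarrow> u \<in> A \<and> v \<in> B \<and> u \<le> v"
  by (induction k) auto

text \<open>A pair enters only when all relevant columns strictly between its ends are already
  paired, whereas \<open>c\<close> is paired at no stage.\<close>

lemma column_pairing_not_straddling:
  assumes "(u, v) \<in> column_pairing A B k" "c \<in> free_columns A B"
  shows "v < c \<or> c < u"
proof (rule ccontr)
  assume neg: "\<not> (v < c \<or> c < u)"
  have "c \<noteq> u" "c \<noteq> v"
    using assms by (auto simp: free_columns_def Field_def)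
  with neg have "u < c" "c < v" by auto
  with assms show False
    by (induction k) (auto simp: free_columns_def)
qed

text \<open>A stage after \<open>k\<close> only adds pairs whose ends lie outside the field of stage
  \<open>k\<close>, so a pair whose left end is in that field is itself present by stage
  \<open>k\<close>.\<close>

lemma column_pairing_fst_unique:
  assumes "(u, v) \<in> column_pairing A B m" "u \<in> Field (column_pairing A B k)"
  shows "v \<in> Field (column_pairing A B k)"
proof (cases "m \<le> k")
  case True
  then show ?thesis using assms(1) column_pairing_mono[OF True, of A B]
    by (auto simp: Field_def)
next
  case False
  then have "k \<le> m" by simp
  then show ?thesis using assms
  proof (induction m rule: dec_induct)
    case base
    then show ?case by (auto simp: Field_def)
  next
    case (step m)
    then show ?case using Field_column_pairing_mono[of k m A B] by auto
  qed
qed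

lemma column_pairing_snd_unique:
  assumes "(u, v) \<in> column_pairing A B m" "v \<in> Field (column_pairing A B k)"
  shows "u \<in> Field (column_pairing A B k)"
proof (cases "m \<le> k")
  case True
  then show ?thesis using assms(1) column_pairing_mono[OF True, of A B]
    by (auto simp: Field_def)
next
  case False
  then have "k \<le> m" by simp
  then show ?thesis using assms
  proof (induction m rule: dec_induct)
    case base
    then show ?case by (auto simp: Field_def)
  next
    case (step m)
    then show ?case using Field_column_pairing_mono[of k m A B] by auto
  qed
qed

text \<open>The fields increase with the stage, so the largest of finitely many stages serves all of
  \<open>W\<close>. This turns "paired eventually" into the single stage required by the pairing
  rule.\<close>

lemma column_pairing_covers:
  assumes "finite W" "W \<subseteq> (\<Union>k. Field (column_pairing A B k))"
  shows "\<exists>k. W \<subseteq> Field (column_pairing A B k)"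
  using assms
proof (induction W rule: finite_induct)
  case empty
  then show ?case by simp
next
  case (insert w W)
  then obtain k l where "W \<subseteq> Field (column_pairing A B k)" "w \<in> Field (column_pairing A B l)"
    by auto
  then have "insert w W \<subseteq> Field (column_pairing A B (max k l))"
    using Field_column_pairing_mono[of k "max k l" A B]
      Field_column_pairing_mono[of l "max k l" A B] by auto
  then show ?case by blast
qed

text \<open>Consider a counterexample \<open>u \<le> v\<close> of minimal distance. Equality is
  excluded by stage 0. A free column strictly between would form a closer counterexample with
  \<open>v\<close> if it is in \<open>A\<close>, with \<open>u\<close> if it is in \<open>B\<close>.
  Hence everything between is paired at some common stage, and the next stage pairs \<open>u\<close>
  with \<open>v\<close>.\<close>

lemma free_columns_order:
  assumes "u \<in> A \<inter> free_columns A B" "v \<in> B \<inter> free_columns A B"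
  shows "v < u"
proof (rule ccontr)
  assume "\<not> v < u"
  then have "u \<le> v" by simp
  then show False using assms
  proof (induction "v - u" arbitrary: u v rule: less_induct)
    case less
    have "u \<noteq> v"
    proof
      assume "u = v"
      with less.prems have "u \<in> Field (column_pairing A B 0)"
        by (auto simp: Field_def)
      with less.prems show False unfolding free_columns_def by blast
    qed
    with less.prems have uv: "u < v" by simp
    let ?W = "{w. u < w \<and> w < v \<and> w \<in> A \<union> B}"
    have "?W \<subseteq> (\<Union>k. Field (column_pairing A B k))"
    proof (rule ccontr)
      assume "\<not> ?thesis"
      then obtain w where w: "u < w" "w < v" "w \<in> A \<union> B" "w \<in> free_columns A B"
        unfolding free_columns_def by blast
      then have "v - w < v - u" "w - u < v - u" by auto
      with w show False
        using less.hyps[of v w] less.hyps[of w u] less.prems by auto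
    qed
    moreover have "finite ?W"
      by (rule finite_subset[of _ "{..<v}"]) auto
    ultimately obtain k where "?W \<subseteq> Field (column_pairing A B k)"
      using column_pairing_covers by blast
    with less.prems uv have "(u, v) \<in> column_pairing A B (Suc k)"
      by (auto simp: free_columns_def)
    then have "u \<in> Field (column_pairing A B (Suc k))"
      by (rule FieldI1)
    with less.prems show False unfolding free_columns_def by blast
  qed
qed

lemma Field_column_pairing_iff_free:
  "w \<in> A \<union> B \<Longrightarrow> w \<notin> free_columns A B \<longleftrightarrow> (\<exists>k. w \<in> Field (column_pairing A B k))"
  by (auto simp: free_columns_def)

text \<open>The union of the two sets stays the same and \<open>c\<close> occurs in no old pair, so
  only a new pair with left end \<open>c\<close> could make a difference. Its right end
  \<open>v\<close> is not free, because \<open>c\<close> is the last free column of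
  \<open>B\<close>; the partner \<open>u\<close> of \<open>v\<close> lies between \<open>c\<close>
  and \<open>v\<close>, hence is already paired, and then so is \<open>v\<close>.\<close>

lemma column_pairing_lower_last_free:
  assumes c: "c \<in> free_columns A B" "c \<in> B"
    and last: "\<And>d. d \<in> B \<inter> free_columns A B \<Longrightarrow> d \<le> c"
  shows "column_pairing (insert c A) (B - {c}) k = column_pairing A B k"
proof (induction k)
  case 0
  have "c \<notin> A"
    \<comment> \<open>With \<open>c\<close> in both roles the order lemma would give
      \<open>c < c\<close>.\<close>
    using free_columns_order[of c A B c] c by auto
  then show ?case by auto
next
  case (Suc k)
  have cF: "c \<notin> Field (column_pairing A B k)" for k
    using c by (auto simp: free_columns_def)
  have no: "v \<notin> B" if "c < v" "v \<notin> Field (column_pairing A B k)"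
    and between: "\<forall>w. c < w \<and> w < v \<and> w \<in> A \<union> B \<longrightarrow> w \<in> Field (column_pairing A B k)" for v
  proof
    assume "v \<in> B"
    with that last[of v] obtain m where m: "v \<in> Field (column_pairing A B m)"
      by (auto simp: free_columns_def)
    have "v \<notin> A"
    proof
      assume "v \<in> A"
      with \<open>v \<in> B\<close> have "v \<in> Field (column_pairing A B 0)"
        by (auto simp: Field_def)
      with that Field_column_pairing_mono[of 0 k A B] show False by auto
    qed
    \<comment> \<open>Being outside \<open>A\<close>, the column \<open>v\<close> can only be the
      right end of its pair.\<close>
    with m obtain u where u: "(u, v) \<in> column_pairing A B m"
      by (auto simp: Field_def dest: column_pairingD)
    then have "c < u"
      using column_pairing_not_straddling[OF u c(1)] that by auto
    moreover have "u \<in> A" "u \<le> v" "u \<noteq> v"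
      using column_pairingD[OF u] \<open>v \<notin> A\<close> by auto
    ultimately have "u \<in> Field (column_pairing A B k)"
      using between by auto
    with column_pairing_fst_unique[OF u] that show False by auto
  qed
  show ?case
    unfolding column_pairing.simps Suc
    using c cF[of k] cF[of "Suc k"] no by (auto simp: Field_def)
qed

text \<open>Mirror image of \<open>column_pairing_lower_last_free\<close>: a new pair would have
  right end \<open>c\<close>, and the partner of its left end lies before \<open>c\<close>, since no
  pair straddles \<open>c\<close>.\<close>

lemma column_pairing_raise_first_free:
  assumes c: "c \<in> free_columns A B" "c \<in> A"
    and first: "\<And>d. d \<in> A \<inter> free_columns A B \<Longrightarrow> c \<le> d"
  shows "column_pairing (A - {c}) (insert c B) k = column_pairing A B k"
proof (induction k)
  case 0
  have "c \<notin> B"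
    using free_columns_order[of c A B c] c by auto
  then show ?case by auto
next
  case (Suc k)
  have cF: "c \<notin> Field (column_pairing A B k)" for k
    using c by (auto simp: free_columns_def)
  have no: "u \<notin> A" if "u < c" "u \<notin> Field (column_pairing A B k)"
    and between: "\<forall>w. u < w \<and> w < c \<and> w \<in> A \<union> B \<longrightarrow> w \<in> Field (column_pairing A B k)" for u
  proof
    assume "u \<in> A"
    with that first[of u] obtain m where m: "u \<in> Field (column_pairing A B m)"
      by (auto simp: free_columns_def)
    have "u \<notin> B"
    proof
      assume "u \<in> B"
      with \<open>u \<in> A\<close> have "u \<in> Field (column_pairing A B 0)"
        by (auto simp: Field_def)
      with that Field_column_pairing_mono[of 0 k A B] show False by auto
    qed
    with m obtain v where v: "(u, v) \<in> column_pairing A B m"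
      by (auto simp: Field_def dest: column_pairingD)
    then have "v < c"
      using column_pairing_not_straddling[OF v c(1)] that by auto
    moreover have "v \<in> B" "u \<le> v" "u \<noteq> v"
      using column_pairingD[OF v] \<open>u \<notin> B\<close> by auto
    ultimately have "v \<in> Field (column_pairing A B k)"
      using between by auto
    with column_pairing_snd_unique[OF v] that show False by auto
  qed
  show ?case
    unfolding column_pairing.simps Suc
    using c cF[of k] cF[of "Suc k"] no by (auto simp: Field_def)
qed

lemma free_columns_cong:
  "A \<union> B = A' \<union> B' \<Longrightarrow> (\<And>k. column_pairing A B k = column_pairing A' B' k)
    \<Longrightarrow> free_columns A B = free_columns A' B'"
  by (simp add: free_columns_def)

section \<open>From cells to columns\<close>

definition columns_of :: "nat \<Rightarrow> (nat \<Rightarrow> nat) \<Rightarrow> (cell \<Rightarrow> nat) \<Rightarrow> nat \<Rightarrow> nat set" where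
  "columns_of n a T v = snd ` {x \<in> diagram n a. T x = v}"

abbreviation free_cols :: "nat \<Rightarrow> (nat \<Rightarrow> nat) \<Rightarrow> nat \<Rightarrow> (cell \<Rightarrow> nat) \<Rightarrow> nat set" where
  "free_cols n a i T \<equiv> free_columns (columns_of n a T i) (columns_of n a T (i + 1))"

lemma columns_ofI: "x \<in> diagram n a \<Longrightarrow> T x = v \<Longrightarrow> snd x \<in> columns_of n a T v"
  by (auto simp: columns_of_def)

text \<open>Stated for an arbitrary relation \<open>P\<close> so that the induction hypothesis of
  \<open>pairing_stage_iff\<close> can be plugged in. The point is to return from a paired column to
  the given cell \<open>z\<close>: if the column contains both entries, it is paired with itself and
  \<open>z\<close> has a partner there; otherwise the side on which the column is paired determines
  the entry of \<open>z\<close>.\<close>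

lemma Field_lift:
  assumes P: "\<And>x y. (x, y) \<in> P \<longleftrightarrow> x \<in> diagram n a \<and> y \<in> diagram n a \<and> T x = i \<and> T y = i + 1
      \<and> (snd x, snd y) \<in> column_pairing (columns_of n a T i) (columns_of n a T (i + 1)) k"
    and z: "z \<in> diagram n a" "T z \<in> {i, i + 1}"
  shows "z \<in> Field P \<longleftrightarrow>
    snd z \<in> Field (column_pairing (columns_of n a T i) (columns_of n a T (i + 1)) k)"
    (is "_ \<longleftrightarrow> _ \<in> Field ?Q")
proof
  assume "z \<in> Field P"
  then show "snd z \<in> Field ?Q" by (auto simp: Field_def P)
next
  assume F: "snd z \<in> Field ?Q"
  let ?c = "snd z"
  show "z \<in> Field P"
  proof (cases "?c \<in> columns_of n a T i \<inter> columns_of n a T (i + 1)")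
    case True
    then have "(?c, ?c) \<in> ?Q"
      using column_pairing_mono[of 0 k "columns_of n a T i" "columns_of n a T (i + 1)"] by auto
    moreover obtain x y where "x \<in> diagram n a" "T x = i" "snd x = ?c"
      "y \<in> diagram n a" "T y = i + 1" "snd y = ?c"
      using True by (auto simp: columns_of_def)
    \<comment> \<open>The partner of \<open>z\<close> is the cell of its own column with the other
      entry.\<close>
    ultimately have "(if T z = i then (z, y) else (x, z)) \<in> P"
      using z by (auto simp: P)
    then show ?thesis by (auto simp: Field_def split: if_splits)
  next
    case False
    from F consider d where "(?c, d) \<in> ?Q" | d where "(d, ?c) \<in> ?Q"
      by (auto simp: Field_def)
    then show ?thesis
    proof cases
      case 1
      then have "T z = i" "d \<in> columns_of n a T (i + 1)"
        using False z columns_ofI[of z n a T] column_pairingD[OF 1] by auto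
      moreover from this obtain y where "y \<in> diagram n a" "T y = i + 1" "snd y = d"
        by (auto simp: columns_of_def)
      ultimately have "(z, y) \<in> P" using z 1 by (auto simp: P)
      then show ?thesis by (rule FieldI1)
    next
      case 2
      then have "T z = i + 1" "d \<in> columns_of n a T i"
        using False z columns_ofI[of z n a T] column_pairingD[OF 2] by auto
      moreover from this obtain x where "x \<in> diagram n a" "T x = i" "snd x = d"
        by (auto simp: columns_of_def)
      ultimately have "(x, z) \<in> P" using z 2 by (auto simp: P)
      then show ?thesis by (rule FieldI2)
    qed
  qed
qed

text \<open>The pairing rule inspects a cell only through its entry and its column, so the stages
  for cells and for columns grow in parallel.\<close>

lemma pairing_stage_iff:
  "(x, y) \<in> pairing_stage n a i T k \<longleftrightarrow>
    x \<in> diagram n a \<and> y \<in> diagram n a \<and> T x = i \<and> T y = i + 1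
    \<and> (snd x, snd y) \<in> column_pairing (columns_of n a T i) (columns_of n a T (i + 1)) k"
proof (induction k arbitrary: x y)
  case 0
  show ?case using columns_ofI[of x n a T] columns_ofI[of y n a T] by auto
next
  case (Suc k)
  note F = Field_lift[of "pairing_stage n a i T k", OF Suc]
  let ?Q = "column_pairing (columns_of n a T i) (columns_of n a T (i + 1)) k"
  let ?AB = "columns_of n a T i \<union> columns_of n a T (i + 1)"
  \<comment> \<open>The rule quantifies over the cells in between; this translates it into a
    condition on columns.\<close>
  have between: "(\<forall>z\<in>diagram n a. c < snd z \<and> snd z < d \<and> T z \<in> {i, i + 1}
      \<longrightarrow> z \<in> Field (pairing_stage n a i T k)) \<longleftrightarrow>
    (\<forall>w. c < w \<and> w < d \<and> w \<in> ?AB \<longrightarrow> w \<in> Field ?Q)" (is "?L \<longleftrightarrow> ?R") for c d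
  proof
    assume L: ?L
    show ?R
    proof (intro allI impI)
      fix w assume w: "c < w \<and> w < d \<and> w \<in> ?AB"
      then obtain z where "z \<in> diagram n a" "T z \<in> {i, i + 1}" "snd z = w"
        by (auto simp: columns_of_def)
      with L w F[of z] show "w \<in> Field ?Q" by blast
    qed
  next
    assume R: ?R
    show ?L
    proof (intro ballI impI)
      fix z assume z: "z \<in> diagram n a" "c < snd z \<and> snd z < d \<and> T z \<in> {i, i + 1}"
      then have "snd z \<in> ?AB" using columns_ofI[of z n a T] by blast
      with R z F[of z] show "z \<in> Field (pairing_stage n a i T k)" by blast
    qed
  qed
  show ?case
  proof (cases "x \<in> diagram n a \<and> y \<in> diagram n a \<and> T x = i \<and> T y = i + 1")
    case True
    then have "snd x \<in> columns_of n a T i" "snd y \<in> columns_of n a T (i + 1)"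
      and "x \<in> Field (pairing_stage n a i T k) \<longleftrightarrow> snd x \<in> Field ?Q"
      and "y \<in> Field (pairing_stage n a i T k) \<longleftrightarrow> snd y \<in> Field ?Q"
      using F[of x] F[of y] columns_ofI[of _ n a T] by blast+
    with True show ?thesis
      unfolding pairing_stage.simps column_pairing.simps
      by (simp only: Un_iff mem_Collect_eq prod.case Suc between) blast
  next
    case False
    then show ?thesis
      unfolding pairing_stage.simps by (simp only: Un_iff mem_Collect_eq prod.case Suc) blast
  qed
qed

lemma unpaired_eq:
  assumes "v \<in> {i, i + 1}"
  shows "unpaired n a i T v = {x \<in> diagram n a. T x = v \<and> snd x \<in> free_cols n a i T}"
proof -
  have "x \<in> Field (\<Union>k. pairing_stage n a i T k) \<longleftrightarrow> snd x \<notin> free_cols n a i T"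
    if "x \<in> diagram n a" "T x = v" for x
  proof -
    have "x \<in> Field (\<Union>k. pairing_stage n a i T k) \<longleftrightarrow> (\<exists>k. x \<in> Field (pairing_stage n a i T k))"
      by (simp add: Field_def) blast
    also have "\<dots> \<longleftrightarrow> (\<exists>k. snd x \<in>
        Field (column_pairing (columns_of n a T i) (columns_of n a T (i + 1)) k))"
      using Field_lift[OF pairing_stage_iff] that assms by auto
    also have "\<dots> \<longleftrightarrow> snd x \<notin> free_cols n a i T"
      using that assms columns_ofI[of x n a T v] by (subst Field_column_pairing_iff_free) auto
    finally show ?thesis .
  qed
  then show ?thesis unfolding unpaired_def by auto
qed

section \<open>Changing an entry\<close>

lemma diagramD: "(r, c) \<in> diagram n a \<Longrightarrow> 1 \<le> r \<and> r \<le> n \<and> 1 \<le> c \<and> c \<le> a r"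
  by (auto simp: diagram_def)

lemma finite_diagram: "finite (diagram n a)"
proof (rule finite_subset)
  show "diagram n a \<subseteq> (SIGMA r:{1..n}. {1..a r})"
    by (auto simp: diagram_def)
qed simp

section \<open>Consequences of the non-attacking condition\<close>

lemma non_attacking_column:
  assumes "non_attacking n a T" "x \<in> diagram n a" "y \<in> diagram n a" "snd x = snd y" "T x = T y"
  shows "x = y"
proof (rule ccontr)
  assume "x \<noteq> y"
  moreover have "aug T x = T x" "aug T y = T y"
    using assms by (auto simp: aug_def diagram_def)
  moreover have "x \<in> aug_diagram n a" "y \<in> aug_diagram n a"
    using assms by (auto simp: aug_diagram_def)
  ultimately show False
    using assms unfolding non_attacking_def attacking_def by metis
qed

lemma non_attacking_adjacent:
  assumes "non_attacking n a T" "(s, d) \<in> diagram n a" "(r, Suc d) \<in> diagram n a" "r < s"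
  shows "T (s, d) \<noteq> T (r, Suc d)"
proof -
  have "aug T (s, d) = T (s, d)" "aug T (r, Suc d) = T (r, Suc d)"
    using assms by (auto simp: aug_def diagram_def)
  then show ?thesis
    using assms unfolding non_attacking_def attacking_def aug_diagram_def by force
qed

text \<open>The basement cell \<open>(s, 0)\<close> contains \<open>s\<close> and attacks every
  lower cell of column 1.\<close>

lemma non_attacking_basement:
  assumes "non_attacking n a T" "(r, 1) \<in> diagram n a" "r < s" "s \<le> n"
  shows "T (r, 1) \<noteq> s"
proof -
  have "(s, 0) \<in> aug_diagram n a" "(r, 1) \<in> aug_diagram n a"
    using assms by (auto simp: aug_diagram_def diagram_def)
  then have "aug T (s, 0) \<noteq> aug T (r, 1)"
    using assms unfolding non_attacking_def attacking_def by force
  then show ?thesis by (auto simp: aug_def)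
qed

section \<open>Swapped and unchanged columns\<close>

lemma change_entry_apply:
  "y \<in> diagram n a \<Longrightarrow> change_entry n a T v w x y =
    (if y = x then w else if snd y \<in> swap_columns n a T v w x then transpose v w (T y) else T y)"
  by (simp add: change_entry_def)

lemma has_above_imp:
  "has_above n a T v w r d \<Longrightarrow> d \<in> columns_of n a T v \<inter> columns_of n a T w"
  unfolding has_above_def columns_of_def by force

lemma has_below_imp:
  "has_below n a T v w r d \<Longrightarrow> d \<in> columns_of n a T v \<inter> columns_of n a T w"
  unfolding has_below_def columns_of_def by force

lemma swap_columns_imp:
  "d \<in> swap_columns n a T v w x \<Longrightarrow> d \<noteq> snd x \<and> d \<in> columns_of n a T v \<inter> columns_of n a T w"
  by (cases x) (auto simp: swap_columns_def dest!: bspec[of _ _ d]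
      dest: has_above_imp has_below_imp)

lemma swap_columns_left:
  "d < c \<Longrightarrow> d \<in> swap_columns n a T v w (r, c) \<longleftrightarrow>
    1 \<le> d \<and> (\<forall>d' \<in> {d..<c}. has_above n a T v w r d')"
  by (auto simp: swap_columns_def)

lemma swap_columns_right:
  "c < d \<Longrightarrow> d \<in> swap_columns n a T v w (r, c) \<longleftrightarrow>
    (\<forall>d' \<in> {c<..d}. has_below n a T v w r d')"
  by (auto simp: swap_columns_def)

lemma change_entry_column_swapped:
  assumes "d \<in> swap_columns n a T v w x" "(s, d) \<in> diagram n a"
  shows "change_entry n a T v w x (s, d) = transpose v w (T (s, d))"
  using assms swap_columns_imp[OF assms(1)] by (auto simp: change_entry_apply)

lemma change_entry_column_fixed:
  assumes "d \<notin> swap_columns n a T v w x" "d \<noteq> snd x" "(s, d) \<in> diagram n a"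
  shows "change_entry n a T v w x (s, d) = T (s, d)"
  using assms by (auto simp: change_entry_apply)

lemma transpose_to_iff: "transpose v w u = w \<longleftrightarrow> u = v" "transpose v w u = v \<longleftrightarrow> u = w"
  by (auto simp: transpose_def)

text \<open>Swapping the two entries of a column exchanges their roles, so the run condition of the
  inverse operator there is the original one.\<close>

lemma has_above_change_swapped:
  assumes "d \<in> swap_columns n a S v w x"
  shows "has_above n a (change_entry n a S v w x) w v r d \<longleftrightarrow> has_above n a S v w r d"
  unfolding has_above_def
  by (simp add: change_entry_column_swapped[OF assms] transpose_to_iff cong: conj_cong)

lemma has_below_change_swapped:
  assumes "d \<in> swap_columns n a S v w x"
  shows "has_below n a (change_entry n a S v w x) w v r d \<longleftrightarrow> has_below n a S v w r d"
  unfolding has_below_def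
  by (simp add: change_entry_column_swapped[OF assms] transpose_to_iff cong: conj_cong)

lemma has_above_change_fixed:
  assumes "d \<notin> swap_columns n a S v w x" "d \<noteq> snd x"
  shows "has_above n a (change_entry n a S v w x) v' w' r d \<longleftrightarrow> has_above n a S v' w' r d"
  unfolding has_above_def
  by (auto simp: change_entry_column_fixed[OF assms])

lemma has_below_change_fixed:
  assumes "d \<notin> swap_columns n a S v w x" "d \<noteq> snd x"
  shows "has_below n a (change_entry n a S v w x) v' w' r d \<longleftrightarrow> has_below n a S v' w' r d"
  unfolding has_below_def
  by (auto simp: change_entry_column_fixed[OF assms])

text \<open>Swapped columns satisfy the inverse condition by construction. Conversely, follow the
  inverse run away from column \<open>c\<close>. Its first column outside \<open>?D\<close> would be
  unchanged, and a \<open>v\<close> in it would attack, or be attacked by, the \<open>v\<close> in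
  row \<open>r\<close> or the adjacent column of \<open>S\<close>.\<close>

lemma swap_columns_change_entry:
  assumes S: "non_attacking n a S" and x: "(r, c) \<in> diagram n a" "S (r, c) = v"
  shows "swap_columns n a (change_entry n a S v w (r, c)) w v (r, c) = swap_columns n a S v w (r, c)"
    (is "swap_columns n a ?T w v ?x = ?D")
proof (intro equalityI subsetI)
  fix d assume d: "d \<in> ?D"
  then have "d \<noteq> c" using swap_columns_imp by fastforce
  then consider "d < c" | "c < d" by linarith
  then show "d \<in> swap_columns n a ?T w v ?x"
  proof cases
    case 1
    with d have "d' \<in> ?D" if "d' \<in> {d..<c}" for d'
      using that by (auto simp: swap_columns_left)
    with 1 d show ?thesis
      by (auto simp: swap_columns_left has_above_change_swapped)
  next
    case 2
    with d have "d' \<in> ?D" if "d' \<in> {c<..d}" for d'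
      using that by (auto simp: swap_columns_right)
    with 2 d show ?thesis
      by (auto simp: swap_columns_right has_below_change_swapped)
  qed
next
  fix d assume d: "d \<in> swap_columns n a ?T w v ?x"
  then have "d \<noteq> c" using swap_columns_imp by fastforce
  then consider "d < c" | "c < d" by linarith
  then show "d \<in> ?D"
  proof cases
    case 1
    then have "d \<le> c" by simp
    have ab: "has_above n a ?T w v r d'" if "d \<le> d'" "d' < c" for d'
      using d 1 that by (auto simp: swap_columns_left)
    have run: "\<forall>e \<in> {d'..<c}. has_above n a S v w r e" if "d \<le> d'" "d' \<le> c" for d'
      using that(2,1)
    \<comment> \<open>The induction starts at \<open>c\<close> and moves left.\<close>
    proof (induction d' rule: inc_induct)
      case base
      then show ?case by simp
    next
      case (step e)
      \<comment> \<open>The right neighbour of column \<open>e\<close> is either \<open>c\<close>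
        itself or already in the original run.\<close>
      have v: "(r, Suc e) \<in> diagram n a \<and> S (r, Suc e) = v"
        using x step by (cases "Suc e = c") (auto simp: has_above_def)
      have "e \<in> ?D"
      proof (rule ccontr)
        assume "e \<notin> ?D"
        with step ab[of e] obtain s where "s > r" "(s, e) \<in> diagram n a" "S (s, e) = v"
          using has_above_change_fixed[of e n a S v w "(r, c)" w v r] by (auto simp: has_above_def)
        with v show False using non_attacking_adjacent[OF S] by metis
      qed
      with step show ?case by (auto simp: swap_columns_left)
    qed
    have "1 \<le> d" using 1 ab[of d] by (auto simp: has_above_def dest: diagramD)
    then show ?thesis using 1 run[of d] by (simp add: swap_columns_left)
  next
    case 2
    have be: "has_below n a ?T w v r d'" if "c < d'" "d' \<le> d" for d'
      using d 2 that by (auto simp: swap_columns_right)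
    have run: "\<forall>e \<in> {c<..d'}. has_below n a S v w r e" if "c \<le> d'" "d' \<le> d" for d'
      using that
    proof (induction d' rule: dec_induct)
      case base
      then show ?case by simp
    next
      case (step e)
      have v: "(r, e) \<in> diagram n a \<and> S (r, e) = v"
        using x step by (cases "e = c") (auto simp: has_below_def)
      have "Suc e \<in> ?D"
      proof (rule ccontr)
        assume "Suc e \<notin> ?D"
        \<comment> \<open>On this side the attacking cell is \<open>(r, e)\<close>; the
          \<open>v\<close> it attacks is the lower cell \<open>(s, Suc e)\<close>.\<close>
        with step be[of "Suc e"] obtain s where
          "s < r" "(s, Suc e) \<in> diagram n a" "S (s, Suc e) = v"
          using has_below_change_fixed[of "Suc e" n a S v w "(r, c)" w v r]
          by (auto simp: has_below_def)
        with v show False using non_attacking_adjacent[OF S] by metis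
      qed
      with step show ?case by (auto simp: swap_columns_right)
    qed
    show ?thesis using 2 run[of d] by (simp add: swap_columns_right)
  qed
qed

text \<open>Both changes swap the same columns, so each transposition is undone and \<open>x\<close>
  regains \<open>v\<close>. Outside the diagram both fillings are undefined by
  extensionality.\<close>

lemma change_entry_inverse:
  assumes S: "non_attacking n a S" "S \<in> extensional (diagram n a)"
    and x: "x \<in> diagram n a" "S x = v"
  shows "change_entry n a (change_entry n a S v w x) w v x = S"
proof
  fix y
  obtain r c where rc: "x = (r, c)" by fastforce
  note D = swap_columns_change_entry[OF S(1), of r c v w, folded rc, OF x]
  show "change_entry n a (change_entry n a S v w x) w v x y = S y"
  proof (cases "y \<in> diagram n a")
    case True
    then show ?thesis
      unfolding change_entry_apply[OF True] D using x(2)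
      by (simp add: transpose_commute[of w v])
  next
    case False
    then show ?thesis
      using extensional_arb[OF S(2) False] by (simp add: change_entry_def)
  qed
qed

text \<open>A swapped column contains both entries before and after, so it stays in both column
  sets. Only the column of \<open>x\<close> moves: its sole \<open>v\<close> is the one at
  \<open>x\<close>, and this becomes a \<open>w\<close>.\<close>

lemma columns_of_change_entry:
  assumes S: "non_attacking n a S" and x: "x \<in> diagram n a" "S x = v"
    and "v \<noteq> w" and free: "snd x \<notin> columns_of n a S w"
  shows "columns_of n a (change_entry n a S v w x) v = columns_of n a S v - {snd x}" (is ?thesis1)
    and "columns_of n a (change_entry n a S v w x) w = insert (snd x) (columns_of n a S w)"
      (is ?thesis2)
proof -
  let ?T = "change_entry n a S v w x"
  have Tx: "?T y = w \<longleftrightarrow> y = x" "?T y \<noteq> v" if "y \<in> diagram n a" "snd y = snd x" for y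
  proof -
    have "snd x \<notin> swap_columns n a S v w x" using swap_columns_imp by blast
    moreover have "S y \<noteq> w" using that free columns_ofI by metis
    moreover have "S y = v \<Longrightarrow> y = x" using non_attacking_column[OF S that(1) x(1) that(2)] x by simp
    ultimately show "?T y = w \<longleftrightarrow> y = x" "?T y \<noteq> v"
      using that \<open>v \<noteq> w\<close> by (auto simp: change_entry_apply)
  qed
  have other: "d \<in> columns_of n a ?T u \<longleftrightarrow> d \<in> columns_of n a S u"
    if d: "d \<noteq> snd x" and u: "u \<in> {v, w}" for d u
  proof (cases "d \<in> swap_columns n a S v w x")
    case True
    then obtain s t where "(s, d) \<in> diagram n a" "S (s, d) = v" "(t, d) \<in> diagram n a" "S (t, d) = w"
      using swap_columns_imp[OF True] by (auto simp: columns_of_def)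
    moreover from this have "?T (s, d) = w" "?T (t, d) = v"
      by (auto simp: change_entry_column_swapped[OF True])
    ultimately have "d \<in> columns_of n a S v" "d \<in> columns_of n a S w"
      "d \<in> columns_of n a ?T v" "d \<in> columns_of n a ?T w"
      using columns_ofI[of "(s, d)" n a] columns_ofI[of "(t, d)" n a] by (metis snd_conv)+
    then show ?thesis using u by blast
  next
    case False
    then have "{y \<in> diagram n a. ?T y = u \<and> snd y = d} = {y \<in> diagram n a. S y = u \<and> snd y = d}"
      using d change_entry_column_fixed[OF False d] by auto
    then show ?thesis unfolding columns_of_def by blast
  qed
  have "snd x \<notin> columns_of n a ?T v" "snd x \<in> columns_of n a ?T w"
    using Tx x by (auto simp: columns_of_def)
  then have "d \<in> columns_of n a ?T v \<longleftrightarrow> d \<in> columns_of n a S v - {snd x}"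
    "d \<in> columns_of n a ?T w \<longleftrightarrow> d \<in> insert (snd x) (columns_of n a S w)" for d
    using other[of d v] other[of d w] by auto
  then show ?thesis1 ?thesis2
    by (intro set_eqI; simp)+
qed

section \<open>The operators\<close>

lemma arg_min_snd_mem:
  fixes X :: "('a \<times> nat) set"
  assumes "X \<noteq> {}"
  shows "arg_min snd (\<lambda>x. x \<in> X) \<in> X \<and> (\<forall>y \<in> X. snd (arg_min snd (\<lambda>x. x \<in> X)) \<le> snd y)"
proof -
  obtain y where y: "y \<in> X" using assms by blast
  from arg_min_nat_lemma[of "\<lambda>x. x \<in> X", OF y, of snd] show ?thesis by blast
qed

lemma arg_max_snd_mem:
  fixes X :: "('a \<times> nat) set"
  assumes "finite X" "X \<noteq> {}"
  shows "arg_max snd (\<lambda>x. x \<in> X) \<in> X \<and> (\<forall>y \<in> X. snd y \<le> snd (arg_max snd (\<lambda>x. x \<in> X)))"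
proof -
  obtain y where y: "y \<in> X" using assms by blast
  \<comment> \<open>\<open>arg_max_nat_lemma\<close> asks for a strict upper bound, hence the
    successor.\<close>
  have "\<forall>z. z \<in> X \<longrightarrow> snd z < Suc (Max (snd ` X))"
    using assms(1) by (simp add: less_Suc_eq_le)
  from arg_max_nat_lemma[of "\<lambda>x. x \<in> X", OF y this] show ?thesis by blast
qed

lemma arg_min_snd_eq:
  fixes X :: "('a \<times> nat) set"
  assumes "x \<in> X" "\<And>y. y \<in> X \<Longrightarrow> y \<noteq> x \<Longrightarrow> snd x < snd y"
  shows "arg_min snd (\<lambda>x. x \<in> X) = x"
proof -
  have "X \<noteq> {}" using assms(1) by blast
  from arg_min_snd_mem[OF this] assms show ?thesis by (metis leD)
qed

lemma arg_max_snd_eq: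
  fixes X :: "('a \<times> nat) set"
  assumes "finite X" "x \<in> X" "\<And>y. y \<in> X \<Longrightarrow> y \<noteq> x \<Longrightarrow> snd y < snd x"
  shows "arg_max snd (\<lambda>x. x \<in> X) = x"
proof -
  have "X \<noteq> {}" using assms(2) by blast
  from arg_max_snd_mem[OF assms(1) this] assms(2,3) show ?thesis by (metis leD)
qed

lemma finite_unpaired: "finite (unpaired n a i T v)"
  by (rule finite_subset[OF _ finite_diagram]) (auto simp: unpaired_def)

text \<open>Three things have to be seen: the cell changed by raising is the leftmost unpaired
  \<open>i\<close> of \<open>T\<close>, the exceptional case of lowering does not occur, and the
  second change undoes the first.\<close>

lemma lowering_inverts_raising:
  assumes i: "1 \<le> i" "i < n"
    and S: "non_attacking n a S" "S \<in> extensional (diagram n a)" and T: "non_attacking n a T"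
    and ST: "raising n a i S = Some T"
  shows "lowering n a i T = Some S"
proof -
  define x where "x = arg_max snd (\<lambda>x. x \<in> unpaired n a i S (i + 1))"
  have ne: "unpaired n a i S (i + 1) \<noteq> {}" and T_eq: "T = change_entry n a S (i + 1) i x"
    using ST by (auto simp: raising_def x_def Let_def split: if_splits)
  have x: "x \<in> unpaired n a i S (i + 1)"
    and x_last: "\<And>y. y \<in> unpaired n a i S (i + 1) \<Longrightarrow> snd y \<le> snd x"
    using arg_max_snd_mem[OF finite_unpaired ne] by (auto simp: x_def)
  let ?c = "snd x"
  let ?A = "columns_of n a S i" and ?B = "columns_of n a S (i + 1)"
  have xd: "x \<in> diagram n a" "S x = i + 1" and free: "?c \<in> free_columns ?A ?B"
    using x by (auto simp: unpaired_eq)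
  have cB: "?c \<in> ?B" using xd by (rule columns_ofI)
  have cA: "?c \<notin> ?A" using free_columns_order[of ?c ?A ?B ?c] free cB by auto
  have cols: "columns_of n a T (i + 1) = ?B - {?c}" "columns_of n a T i = insert ?c ?A"
    using columns_of_change_entry[OF S(1) xd _ cA] by (auto simp: T_eq)
  have last: "d \<le> ?c" if "d \<in> ?B \<inter> free_columns ?A ?B" for d
    using that x_last by (auto simp: unpaired_eq columns_of_def)
  \<comment> \<open>The column \<open>?c\<close> changes sides but remains free, as do all other
    free columns.\<close>
  have fc: "free_cols n a i T = free_columns ?A ?B"
    unfolding cols using column_pairing_lower_last_free[OF free cB last] cB
    by (intro free_columns_cong) auto
  have Tx: "T x = i" using xd by (simp add: T_eq change_entry_apply)
  have xT: "x \<in> unpaired n a i T i"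
    using xd Tx free fc by (simp add: unpaired_eq)
  have "snd x < snd y" if y: "y \<in> unpaired n a i T i" "y \<noteq> x" for y
  proof -
    have yd: "y \<in> diagram n a" "T y = i" "snd y \<in> free_columns ?A ?B"
      using y fc by (auto simp: unpaired_eq)
    have "snd y \<noteq> ?c" using non_attacking_column[OF T yd(1) xd(1)] yd Tx y by auto
    \<comment> \<open>Any other unpaired \<open>i\<close> of \<open>T\<close> is in a column that is
      free in \<open>S\<close> and had an \<open>i\<close> there, so it lies to the right of the
      free \<open>i + 1\<close> in column \<open>?c\<close>.\<close>
    then have "snd y \<in> ?A" using columns_ofI[of y n a T, OF yd(1,2)] cols by auto
    then show ?thesis using free_columns_order[of "snd y" ?A ?B ?c] yd free cB by auto
  qed
  then have argmin: "arg_min snd (\<lambda>x. x \<in> unpaired n a i T i) = x"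
    by (intro arg_min_snd_eq xT)
  have "\<not> (fst x = i \<and> (\<forall>d \<in> {1..<snd x}. has_above n a T i (i + 1) i d))"
  proof
    assume asm: "fst x = i \<and> (\<forall>d \<in> {1..<snd x}. has_above n a T i (i + 1) i d)"
    then have xi: "x = (i, ?c)" by (cases x) auto
    have D: "swap_columns n a T i (i + 1) (i, ?c) = swap_columns n a S (i + 1) i (i, ?c)"
      using swap_columns_change_entry[OF S(1), of i ?c "i + 1" i] xd
      unfolding T_eq xi[symmetric] by simp
    \<comment> \<open>In the exceptional case the swaps reach column 1, or \<open>x\<close> itself
      is there; either way \<open>S\<close> has \<open>i + 1\<close> in row \<open>i\<close>, which
      the basement entry \<open>i + 1\<close> of row \<open>i + 1\<close> attacks. That row exists
      because \<open>i < n\<close>.\<close>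
    have "(i, 1) \<in> diagram n a \<and> S (i, 1) = i + 1"
    proof (cases "?c = 1")
      case True
      with xi xd show ?thesis by simp
    next
      case False
      with xd have "1 < ?c" by (cases x) (auto simp: diagram_def)
      then have "1 \<in> swap_columns n a S (i + 1) i (i, ?c)"
        unfolding D[symmetric] using asm by (auto simp: swap_columns_left)
      with \<open>1 < ?c\<close> show ?thesis by (auto simp: swap_columns_left has_above_def)
    qed
    then show False using non_attacking_basement[OF S(1), of i "i + 1"] i by auto
  qed
  moreover have "change_entry n a T i (i + 1) x = S"
    unfolding T_eq by (rule change_entry_inverse[OF S xd])
  ultimately show ?thesis
    using xT by (auto simp: lowering_def argmin Let_def)
qed

text \<open>The same argument with left and right exchanged. The value \<open>Some S\<close> already
  says that lowering was not in its exceptional case, and raising has none.\<close>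

lemma raising_inverts_lowering:
  assumes S: "non_attacking n a S"
    and T: "non_attacking n a T" "T \<in> extensional (diagram n a)"
    and TS: "lowering n a i T = Some S"
  shows "raising n a i S = Some T"
proof -
  define x where "x = arg_min snd (\<lambda>x. x \<in> unpaired n a i T i)"
  have ne: "unpaired n a i T i \<noteq> {}" and S_eq: "S = change_entry n a T i (i + 1) x"
    using TS by (auto simp: lowering_def x_def Let_def split: if_splits)
  have x: "x \<in> unpaired n a i T i"
    and x_first: "\<And>y. y \<in> unpaired n a i T i \<Longrightarrow> snd x \<le> snd y"
    using arg_min_snd_mem[OF ne] by (auto simp: x_def)
  let ?c = "snd x"
  let ?A = "columns_of n a T i" and ?B = "columns_of n a T (i + 1)"
  have xd: "x \<in> diagram n a" "T x = i" and free: "?c \<in> free_columns ?A ?B"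
    using x by (auto simp: unpaired_eq)
  have cA: "?c \<in> ?A" using xd by (rule columns_ofI)
  have cB: "?c \<notin> ?B" using free_columns_order[of ?c ?A ?B ?c] free cA by auto
  have cols: "columns_of n a S i = ?A - {?c}" "columns_of n a S (i + 1) = insert ?c ?B"
    using columns_of_change_entry[OF T(1) xd _ cB] by (auto simp: S_eq)
  have first: "?c \<le> d" if "d \<in> ?A \<inter> free_columns ?A ?B" for d
    using that x_first by (auto simp: unpaired_eq columns_of_def)
  have fc: "free_cols n a i S = free_columns ?A ?B"
    unfolding cols using column_pairing_raise_first_free[OF free cA first] cA
    by (intro free_columns_cong) auto
  have Sx: "S x = i + 1" using xd by (simp add: S_eq change_entry_apply)
  have xS: "x \<in> unpaired n a i S (i + 1)"
    using xd Sx free fc by (simp add: unpaired_eq)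
  have "snd y < snd x" if y: "y \<in> unpaired n a i S (i + 1)" "y \<noteq> x" for y
  proof -
    have yd: "y \<in> diagram n a" "S y = i + 1" "snd y \<in> free_columns ?A ?B"
      using y fc by (auto simp: unpaired_eq)
    have "snd y \<noteq> ?c" using non_attacking_column[OF S yd(1) xd(1)] yd Sx y by auto
    then have "snd y \<in> ?B" using columns_ofI[of y n a S, OF yd(1,2)] cols by auto
    then show ?thesis using free_columns_order[of ?c ?A ?B "snd y"] yd free cA by auto
  qed
  then have argmax: "arg_max snd (\<lambda>x. x \<in> unpaired n a i S (i + 1)) = x"
    by (intro arg_max_snd_eq finite_unpaired xS)
  have "change_entry n a S (i + 1) i x = T"
    unfolding S_eq by (rule change_entry_inverse[OF T xd])
  then show ?thesis
    using xS argmax by (auto simp: raising_def Let_def)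
qed

theorem theorem5p14:
  fixes n i :: nat and a :: "nat \<Rightarrow> nat" and S T :: "cell \<Rightarrow> nat"
  assumes "1 \<le> i" and "i < n"
    and "S \<in> SSKD n a" and "T \<in> SSKD n a"
  shows "raising n a i S = Some T \<longleftrightarrow> lowering n a i T = Some S"
proof -
  have "non_attacking n a S" "S \<in> extensional (diagram n a)"
    "non_attacking n a T" "T \<in> extensional (diagram n a)"
    using assms by (auto simp: SSKD_def fillings_def PiE_def)
  then show ?thesis
    using assms lowering_inverts_raising raising_inverts_lowering by blast
qed

end
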